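(* Let $k \geq 1$ and $n \geq 1$, and let $\pi \in S(n)$ be a permutation whose reduced cycle type is $\mu \vdash k$, and let $\lambda \vdash k$ be another partition of $k$. Then the number of primitive factorizations of $\pi$ of type $\lambda$ equals $$\sum_{(\lambda^{(1)},\dots,\lambda^{(\ell(\mu))}) \in \mathfrak{R}(\lambda,\mu)} \operatorname{RC}(\lambda^{(1)}) \cdots \operatorname{RC}(\lambda^{(\ell(\mu))}).$$
   Context: A factorization $\pi = (s_1,t_1)\cdots(s_m,t_m)$ of $\pi \in S(n)$ into transpositions, written with $s_i<t_i$, is called primitive if $2 \leq t_1 \leq t_2 \leq \dots \leq t_m \leq n$. Such a factorization then has the form of $a_2$ transpositions of the form $( *,2)$, followed by $a_3$ of the form $( *,3)$, ..., followed by $a_n$ of the form $( *,n)$, with $a_2+\dots+a_n=m$; it is said to be of type $\lambda \vdash m$ if the nonzero numbers among $a_2,\dots,a_n$, sorted in weakly decreasing order, are the parts of $\lambda$. (So a factorization of type $\lambda$ uses $|\lambda|$ transpositions.) The reduced cycle type of $\pi$ is the partition obtained from its cycle type by subtracting one from each cycle length (and discarding zeros); its size is the minimal number of transpositions needed to express $\pi$. For $k\ge1$, let $\mathfrak{E}(k)$ be the set of weakly increasing sequences $i_1 \leq \dots \leq i_k$ of positive integers with $i_p \geq p$ for $1 \leq p \leq k-1$ and $i_k = k$. The type of such a sequence is the partition whose parts are the multiplicities of the distinct values occurring in it. For $\lambda \vdash k$, $\operatorname{RC}(\lambda)$ is the number of sequences in $\mathfrak{E}(k)$ of type $\lambda$.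 For partitions $\lambda,\mu \vdash k$, $\mathfrak{R}(\lambda,\mu)$ is the set of sequences $(\lambda^{(1)},\dots,\lambda^{(\ell(\mu))})$ of partitions with $\lambda^{(i)} \vdash \mu_i$ for each $i$ and such that the multiset union of the parts of $\lambda^{(1)},\dots,\lambda^{(\ell(\mu))}$ equals the multiset of parts of $\lambda$. Here $\ell(\mu)$ denotes the number of parts of $\mu$. *)

theory Defs
  imports "HOL-Library.Multiset" "HOL-Combinatorics.Orbits"
begin

definition integer_partition :: "nat \<Rightarrow> nat list \<Rightarrow> bool" where
  "integer_partition k p \<longleftrightarrow> sorted_wrt (\<ge>) p \<and> 0 \<notin> set p \<and> sum_list p = k"

definition decreasing_list :: "nat multiset \<Rightarrow> nat list" where
  "decreasing_list M = rev (sorted_list_of_multiset M)"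

text \<open>
  The cycles of a permutation of \<open>{1..n}\<close> are its orbits on \<open>{1..n}\<close>, fixed points included;
  the image \<open>orbit \<pi> ` {1..n}\<close> is a set, so every cycle contributes exactly one length.
\<close>

definition cycle_type :: "nat \<Rightarrow> (nat \<Rightarrow> nat) \<Rightarrow> nat list" where
  "cycle_type n \<pi> = decreasing_list (image_mset card (mset_set (orbit \<pi> ` {1..n})))"

definition reduced_cycle_type :: "nat \<Rightarrow> (nat \<Rightarrow> nat) \<Rightarrow> nat list" where
  "reduced_cycle_type n \<pi> = filter (\<lambda>c. c \<noteq> 0) (map (\<lambda>c. c - 1) (cycle_type n \<pi>))"

text \<open>
  A factorization is the list of its pairs \<open>(s, t)\<close> with \<open>s < t\<close>. Products are compositions
  of functions, so the last transposition is applied first. The condition \<open>2 \<le> t\<close> is implied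
  by \<open>1 \<le> s < t\<close>.
\<close>

definition primitive_factorization :: "nat \<Rightarrow> (nat \<Rightarrow> nat) \<Rightarrow> (nat \<times> nat) list \<Rightarrow> bool" where
  "primitive_factorization n \<pi> fs \<longleftrightarrow>
     (\<forall>(s, t) \<in> set fs. 1 \<le> s \<and> s < t \<and> t \<le> n) \<and> sorted (map snd fs) \<and> apply_transps fs = \<pi>"

definition factorization_type :: "nat \<Rightarrow> (nat \<times> nat) list \<Rightarrow> nat list" where
  "factorization_type n fs =
     decreasing_list (filter_mset (\<lambda>a. a \<noteq> 0)
       (image_mset (\<lambda>j. count_list (map snd fs) j) (mset_set {2..n})))"

text \<open>
  The set \<open>E(k)\<close>, meant for \<open>k \<ge> 1\<close>. Lists are indexed from \<open>0\<close>, so \<open>i\<^sub>p\<close> is \<open>xs ! (p - 1)\<close>.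
\<close>

definition E_seqs :: "nat \<Rightarrow> nat list set" where
  "E_seqs k = {xs. length xs = k \<and> sorted xs \<and> (\<forall>i \<in> set xs. 0 < i) \<and>
                   (\<forall>p \<in> {1..k - 1}. p \<le> xs ! (p - 1)) \<and> xs ! (k - 1) = k}"

definition seq_type :: "nat list \<Rightarrow> nat list" where
  "seq_type xs = decreasing_list (image_mset (count_list xs) (mset_set (set xs)))"

definition RC :: "nat list \<Rightarrow> nat" where
  "RC p = card {xs \<in> E_seqs (sum_list p). seq_type xs = p}"

definition refinements :: "nat list \<Rightarrow> nat list \<Rightarrow> nat list list set" where
  "refinements lam mu = {ps. length ps = length mu \<and>
     (\<forall>i < length mu. integer_partition (mu ! i) (ps ! i)) \<and> mset (concat ps) = mset lam}"

text \<open>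
  All sets that are counted or summed over are finite, so \<^const>\<open>card\<close> and \<^const>\<open>sum\<close> have
  their intended meaning.
\<close>

lemma finite_E_seqs: "finite (E_seqs k)"
proof (rule finite_subset)
  show "E_seqs k \<subseteq> {xs. set xs \<subseteq> {0..k} \<and> length xs = k}"
  proof
    fix xs assume a: "xs \<in> E_seqs k"
    have "x \<le> k" if x: "x \<in> set xs" for x
    proof -
      obtain j where "j < k" "xs ! j = x"
        using x a by (auto simp: E_seqs_def in_set_conv_nth)
      then show ?thesis
        using sorted_nth_mono[of xs j "k - 1"] a by (auto simp: E_seqs_def)
    qed
    then show "xs \<in> {xs. set xs \<subseteq> {0..k} \<and> length xs = k}"
      using a by (auto simp: E_seqs_def)
  qed
qed (simp add: finite_lists_length_eq)

lemma finite_integer_partitions: "finite {p. integer_partition k p}"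
proof (rule finite_subset)
  show "{p. integer_partition k p} \<subseteq> {p. set p \<subseteq> {0..k} \<and> length p \<le> k}"
  proof
    fix p assume "p \<in> {p. integer_partition k p}"
    then have p: "0 \<notin> set p" "sum_list p = k" by (auto simp: integer_partition_def)
    have "length p \<le> sum_list p" using p(1) by (induction p) auto
    then show "p \<in> {p. set p \<subseteq> {0..k} \<and> length p \<le> k}"
      using p(2) member_le_sum_list[of _ p] by auto
  qed
qed (simp add: finite_lists_length_le)

lemma finite_refinements: "finite (refinements lam mu)"
proof (rule finite_subset)
  show "refinements lam mu \<subseteq>
          {ps. set ps \<subseteq> (\<Union>m \<in> set mu. {p. integer_partition m p}) \<and> length ps = length mu}"
    by (fastforce simp: refinements_def in_set_conv_nth)
qed (auto intro!: finite_lists_length_eq finite_integer_partitions)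

lemma sum_list_decreasing_list: "sum_list (decreasing_list M) = sum_mset M"
  by (simp add: decreasing_list_def sum_mset_sum_list[symmetric])

lemma sum_list_factorization_type:
  assumes "primitive_factorization n \<pi> fs"
  shows "sum_list (factorization_type n fs) = length fs"
proof -
  have sub: "set (map snd fs) \<subseteq> {2..n}"
    using assms by (fastforce simp: primitive_factorization_def)
  have "sum_mset (filter_mset (\<lambda>a. a \<noteq> 0) M) = sum_mset M" for M :: "nat multiset"
    by (induction M) auto
  then have "sum_list (factorization_type n fs) = (\<Sum>j\<in>{2..n}. count_list (map snd fs) j)"
    by (simp add: factorization_type_def sum_list_decreasing_list sum_unfold_sum_mset)
  also have "\<dots> = length fs"
    using sub
    by (metis sum_count_set[of "map snd fs" "{2..n}"] finite_atLeastAtMost length_map)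
  finally show ?thesis .
qed

lemma finite_primitive_factorizations:
  "finite {fs. primitive_factorization n \<pi> fs \<and> factorization_type n fs = lam}"
proof (rule finite_subset)
  show "{fs. primitive_factorization n \<pi> fs \<and> factorization_type n fs = lam} \<subseteq>
          {fs. set fs \<subseteq> {0..n} \<times> {0..n} \<and> length fs = sum_list lam}"
    using sum_list_factorization_type by (fastforce simp: primitive_factorization_def)
qed (simp add: finite_lists_length_eq)

end

theory Submission
  imports Defs
begin

text \<open>
  Both sides count lists of plane trees. A minimal primitive factorization is undone from its
  right end: multiplying \<open>\<pi>\<close> by its last transposition \<open>(s, n)\<close> must split the cycle
  \<open>(x\<^sub>1 \<dots> x\<^sub>m n)\<close> of \<open>n\<close>, so \<open>s = x\<^sub>j\<close> for some \<open>j\<close>, and \<open>(x\<^sub>1 \<dots> x\<^sub>j)\<close> becomes a cycle of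
  its own. This obeys the same recursion as removing the first subtree, one with \<open>j - 1\<close> edges,
  from the root of a plane tree with \<open>m\<close> edges; the number of transpositions \<open>(*, n)\<close> is the
  number of children of the root. Hence the factorizations of type \<open>\<lambda>\<close> are equinumerous with the
  lists of plane trees, one with \<open>l - 1\<close> edges for each cycle of length \<open>l\<close>, whose nonzero
  numbers of children are together the parts of \<open>\<lambda>\<close>. On the other side, a sequence in \<open>E(k)\<close> is
  the Lukasiewicz word of a plane tree with \<open>k\<close> edges, given by the multiplicities of
  \<open>k, \<dots>, 1, 0\<close>.
\<close>

subsection \<open>Plane trees\<close>

datatype tree = Node "tree list"

primrec edges :: "tree \<Rightarrow> nat" where
  "edges (Node ts) = (\<Sum>t\<leftarrow>ts. Suc (edges t))"

text \<open>Turns a number into a multiset that drops zeros, so that degrees and types become plain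
  sums of multisets.\<close>

definition nonzero :: "nat \<Rightarrow> nat multiset" where
  "nonzero a = (if a = 0 then {#} else {#a#})"

primrec degrees :: "tree \<Rightarrow> nat multiset" where
  "degrees (Node ts) = nonzero (length ts) + (\<Sum>t\<leftarrow>ts. degrees t)"

abbreviation forest_degrees :: "tree list \<Rightarrow> nat multiset" where
  "forest_degrees ts \<equiv> (\<Sum>t\<leftarrow>ts. degrees t)"

lemma sum_mset_nonzero [simp]: "sum_mset (nonzero a) = a"
  by (simp add: nonzero_def)

lemma nonzero_0 [simp]: "nonzero 0 = {#}"
  by (simp add: nonzero_def)

lemma not_zero_in_nonzero [simp]: "0 \<notin># nonzero a"
  by (simp add: nonzero_def)

text \<open>Every edge is counted exactly once, at its upper end.\<close>

lemma sum_mset_degrees: "sum_mset (degrees t) = edges t"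
proof (induction t)
  case (Node ts)
  then have "sum_mset (forest_degrees ts) + length ts = (\<Sum>t\<leftarrow>ts. Suc (edges t))"
    by (induction ts) auto
  then show ?case by simp
qed

lemma zero_notin_degrees: "0 \<notin># degrees t"
proof (induction t)
  case (Node ts)
  then have "0 \<notin># forest_degrees ts" by (induction ts) auto
  then show ?case by simp
qed

text \<open>A nonempty list of children splits into the first child and the rest, both with fewer
  edges than the whole, so strong induction applies.\<close>

lemma finite_trees: "finite {t. edges t = m}"
proof -
  have "finite {ts. edges (Node ts) = m}" for m
  proof (induction m rule: less_induct)
    case (less m)
    have "{ts. edges (Node ts) = m} \<subseteq>
        insert [] ((\<lambda>(r, ts). Node r # ts) `
          ((\<Union>j<m. {ts. edges (Node ts) = j}) \<times> (\<Union>j<m. {ts. edges (Node ts) = j})))"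
    proof
      fix ts assume "ts \<in> {ts. edges (Node ts) = m}"
      then have ts: "edges (Node ts) = m" by simp
      show "ts \<in> insert [] ((\<lambda>(r, ts). Node r # ts) `
          ((\<Union>j<m. {ts. edges (Node ts) = j}) \<times> (\<Union>j<m. {ts. edges (Node ts) = j})))"
      proof (cases ts)
        case (Cons t ts')
        obtain r where "t = Node r" by (cases t)
        then show ?thesis
          using ts Cons by (intro insertI2 image_eqI[of _ _ "(r, ts')"]) auto
      qed auto
    qed
    then show ?case
      by (rule finite_subset) (intro finite.insertI finite_imageI finite_cartesian_product finite_UN_I
        finite_lessThan less.IH; simp)
  qed
  from finite_imageI[OF this[of m], of Node] show ?thesis
    by (rule finite_subset[rotated]) (metis (mono_tags, lifting) image_eqI mem_Collect_eq subsetI tree.exhaust)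
qed

subsection \<open>Forests with prescribed sizes\<close>

definition forests :: "nat list \<Rightarrow> nat multiset \<Rightarrow> tree list set" where
  "forests es M = {ts. map edges ts = es \<and> forest_degrees ts = M}"

lemma finite_forests: "finite (forests es M)"
proof (rule finite_subset)
  show "forests es M \<subseteq> {ts. set ts \<subseteq> (\<Union>e\<in>set es. {t. edges t = e}) \<and> length ts = length es}"
    by (auto simp: forests_def)
qed (intro finite_lists_length_eq finite_UN_I finite_set finite_trees)

text \<open>Permuting the trees along with the sizes is injective and preserves the multiset of
  degrees. One inequality suffices, by symmetry.\<close>

lemma card_forests_mset_cong:
  assumes "mset es = mset es'"
  shows "card (forests es M) = card (forests es' M)"
proof -
  have le: "card (forests es M) \<le> card (forests es' M)" if eq: "mset es = mset es'" for es es'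
  proof -
    obtain f where f: "f permutes {..<length es}" "permute_list f es = es'"
      using mset_eq_permutation[OF eq[symmetric]] by blast
    have len: "length ts = length es" if "ts \<in> forests es M" for ts
      using that by (auto simp: forests_def)
    have "inj_on (permute_list f) (forests es M)"
    proof (rule inj_onI)
      fix ts us assume a: "ts \<in> forests es M" "us \<in> forests es M" "permute_list f ts = permute_list f us"
      show "ts = us"
      proof (rule nth_equalityI)
        fix i assume "i < length ts"
        then have "i \<in> f ` {..<length es}"
          using len[OF a(1)] permutes_image[OF f(1)] by simp
        then obtain j where j: "j < length ts" "f j = i"
          using len[OF a(1)] by auto
        show "ts ! i = us ! i"
          using arg_cong[OF a(3), of "\<lambda>l. l ! j"] j len[OF a(1)] len[OF a(2)]
          by (simp add: permute_list_def)
      qed (use len a in simp)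
    qed
    moreover have "permute_list f ` forests es M \<subseteq> forests es' M"
    proof clarify
      fix ts assume a: "ts \<in> forests es M"
      have "map edges (permute_list f ts) = es'"
        using a f permute_list_map[of f ts edges] len[OF a] by (simp add: forests_def)
      moreover have "forest_degrees (permute_list f ts) = forest_degrees ts"
        using f(1) len[OF a] mset_permute_list[of f ts]
        by (simp add: mset_map flip: sum_mset_sum_list)
      ultimately show "permute_list f ts \<in> forests es' M"
        using a by (simp add: forests_def)
    qed
    ultimately show ?thesis by (rule card_inj_on_le) (rule finite_forests)
  qed
  from le[OF assms] le[OF assms[symmetric]] show ?thesis by simp
qed

lemma edges_eq_0_iff: "edges t = 0 \<longleftrightarrow> t = Node []"
proof (cases t)
  case (Node ts)
  then show ?thesis by (cases ts) simp_all
qed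

lemma card_forests_0_Cons: "card (forests (0 # es) M) = card (forests es M)"
proof -
  have "forests (0 # es) M = Cons (Node []) ` forests es M"
    by (auto simp: forests_def image_iff map_eq_Cons_conv edges_eq_0_iff)
  then show ?thesis by (simp add: card_image)
qed

text \<open>Trees without edges contribute no degrees; moved to the front, they can be removed one
  by one. This accounts for the fixed points of the permutation.\<close>

lemma card_forests_filter: "card (forests (filter (\<lambda>e. e \<noteq> 0) es) M) = card (forests es M)"
proof -
  have "card (forests (replicate z 0 @ es') M) = card (forests es' M)" for z es'
    by (induction z) (simp_all add: card_forests_0_Cons)
  moreover have "card (forests es M) =
      card (forests (replicate (count (mset es) 0) 0 @ filter (\<lambda>e. e \<noteq> 0) es) M)"
    by (rule card_forests_mset_cong, induction es) auto
  ultimately show ?thesis by simp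
qed

subsection \<open>Lukasiewicz words\<close>

text \<open>
  \<open>good_word a w\<close> says that \<open>w\<close> is the list of numbers of children, in depth-first order, of
  a forest of \<open>a\<close> trees.
\<close>

fun good_word :: "nat \<Rightarrow> nat list \<Rightarrow> bool" where
  "good_word a [] \<longleftrightarrow> a = 0"
| "good_word a (x # w) \<longleftrightarrow> 0 < a \<and> good_word (a - 1 + x) w"

primrec word :: "tree \<Rightarrow> nat list" where
  "word (Node ts) = length ts # concat (map word ts)"

abbreviation forest_word :: "tree list \<Rightarrow> nat list" where
  "forest_word ts \<equiv> concat (map word ts)"

lemma length_word: "length (word t) = Suc (edges t)"
proof (induction t)
  case (Node ts)
  then have "length (forest_word ts) = (\<Sum>t\<leftarrow>ts. Suc (edges t))"
    by (induction ts) auto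
  then show ?case by simp
qed

lemma degrees_word: "degrees t = filter_mset (\<lambda>a. a \<noteq> 0) (mset (word t))"
proof (induction t)
  case (Node ts)
  then have "forest_degrees ts = filter_mset (\<lambda>a. a \<noteq> 0) (mset (forest_word ts))"
    by (induction ts) auto
  then show ?case by (simp add: nonzero_def)
qed

text \<open>The first argument of \<open>good_word\<close> counts the trees still to be read; the
  word of a tree uses up exactly one of them.\<close>

lemma good_word_append_word: "good_word (Suc a) (word t @ w) = good_word a w"
proof (induction t arbitrary: a w)
  case (Node ts)
  then have "good_word (a + length ts) (forest_word ts @ w) = good_word a w"
    by (induction ts arbitrary: w) auto
  then show ?case by simp
qed

text \<open>Unique decoding: in a word starting with \<open>x\<close>, the rest codes a forest whose
  first \<open>x\<close> trees are the children of the first root.\<close>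

lemma ex1_forest_word: "good_word a w \<Longrightarrow> \<exists>!ts. length ts = a \<and> forest_word ts = w"
proof (induction w arbitrary: a)
  case Nil
  show ?case
  proof (rule ex1I[of _ "[]"])
    show "length [] = a \<and> forest_word [] = []" using Nil by simp
  next
    fix ts assume "length ts = a \<and> forest_word ts = []"
    then show "ts = []" using Nil by simp
  qed
next
  case (Cons x w)
  then obtain b where b: "a = Suc b" and g: "good_word (b + x) w"
    by (cases a) auto
  from Cons.IH[OF g] obtain us where us: "length us = b + x" "forest_word us = w"
    and uniq: "\<And>vs. length vs = b + x \<Longrightarrow> forest_word vs = w \<Longrightarrow> vs = us"
    by blast
  show ?case
  proof (rule ex1I[of _ "Node (take x us) # drop x us"])
    have "forest_word (take x us) @ forest_word (drop x us) = w"
      using us(2) by (metis append_take_drop_id concat_append map_append)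
    then show "length (Node (take x us) # drop x us) = a \<and>
        forest_word (Node (take x us) # drop x us) = x # w"
      using us b by simp
  next
    fix ts assume ts: "length ts = a \<and> forest_word ts = x # w"
    then obtain r ts' where r: "ts = Node r # ts'"
      using b by (metis length_Suc_conv tree.exhaust)
    then have "r @ ts' = us" "length r = x"
      using ts b uniq[of "r @ ts'"] by auto
    then show "ts = Node (take x us) # drop x us" using r by auto
  qed
qed

lemma bij_betw_word:
  "bij_betw word {t. edges t = m} {w. good_word 1 w \<and> length w = Suc m}"
  unfolding bij_betw_def
proof
  have good: "good_word 1 (word t)" for t
    using good_word_append_word[of 0 t "[]"] by simp
  show "inj_on word {t. edges t = m}"
  proof (rule inj_onI)
    fix t u assume eq: "word t = word u"
    obtain ts where "\<And>vs. length vs = 1 \<Longrightarrow> forest_word vs = word t \<Longrightarrow> vs = ts"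
      using ex1_forest_word[OF good[of t]] by blast
    from this[of "[t]"] this[of "[u]"] have "[t] = [u]" using eq by simp
    then show "t = u" by simp
  qed
  show "word ` {t. edges t = m} = {w. good_word 1 w \<and> length w = Suc m}"
  proof (intro equalityI subsetI)
    fix w assume w: "w \<in> {w. good_word 1 w \<and> length w = Suc m}"
    then obtain ts where "length ts = 1" "forest_word ts = w"
      using ex1_forest_word[of 1 w] by blast
    then obtain t where "word t = w" by (cases ts) auto
    then show "w \<in> word ` {t. edges t = m}"
      using w length_word[of t] by auto
  qed (use good length_word in auto)
qed

text \<open>Letter \<open>x\<close> followed by \<open>v\<close> further letters contributes \<open>x\<close> copies of the value \<open>v\<close>.\<close>

primrec word_seq :: "nat list \<Rightarrow> nat list" where
  "word_seq [] = []"
| "word_seq (x # w) = word_seq w @ replicate x (length w)"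

lemma word_seq_less: "i \<in> set (word_seq w) \<Longrightarrow> i < length w"
  by (induction w) (auto simp: less_SucI)

lemma sorted_word_seq: "sorted (word_seq w)"
  by (induction w) (auto simp: sorted_append dest: word_seq_less)

text \<open>Distinct positions of \<open>w\<close> produce distinct values, so the multiplicities
  are exactly the nonzero letters.\<close>

lemma word_seq_type:
  "image_mset (count_list (word_seq w)) (mset_set (set (word_seq w))) =
    filter_mset (\<lambda>a. a \<noteq> 0) (mset w)"
proof (induction w)
  case (Cons x w)
  let ?l = "length w" and ?s = "word_seq w"
  have notin: "?l \<notin> set ?s" using word_seq_less by blast
  have c: "count_list (replicate x ?l) i = (if i = ?l then x else 0)" for i
    by (induction x) auto
  define f where "f = count_list (word_seq (x # w))"
  have f_old: "image_mset f (mset_set (set ?s)) = image_mset (count_list ?s) (mset_set (set ?s))"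
    using notin by (intro image_mset_cong) (auto simp: f_def c)
  have f_new: "f ?l = x"
    using notin by (simp add: f_def c count_notin)
  have set: "set (word_seq (x # w)) = (if x = 0 then set ?s else insert ?l (set ?s))"
    by (cases x) auto
  have "image_mset f (mset_set (set (word_seq (x # w)))) = filter_mset (\<lambda>a. a \<noteq> 0) (mset (x # w))"
    unfolding set using notin Cons.IH f_old f_new by (cases "x = 0") simp_all
  then show ?case by (simp only: f_def)
qed simp

text \<open>If the length equation holds, \<open>l - s\<close> trees are pending before a suffix of
  length \<open>l\<close> and letter sum \<open>s\<close>. The sequence has exactly \<open>s\<close>
  entries below \<open>l\<close>, so the inequalities mean \<open>s < l\<close> for every nonempty
  suffix.\<close>

lemma good_word_iff_word_seq:
  "good_word a w \<longleftrightarrow>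
    length (word_seq w) + a = length w \<and> (\<forall>p < length (word_seq w). p < word_seq w ! p)"
proof (induction w arbitrary: a)
  case (Cons x w)
  let ?l = "length w" and ?s = "word_seq w"
  show ?case
  proof (cases "a = 0")
    case True
    have "\<exists>p<length (word_seq (x # w)). \<not> p < word_seq (x # w) ! p"
      if len: "length (word_seq (x # w)) = Suc ?l"
    proof -
      have "word_seq (x # w) ! ?l \<in> set (word_seq (x # w))"
        by (rule nth_mem) (use len in simp)
      then have "word_seq (x # w) ! ?l < Suc ?l"
        using word_seq_less[of _ "x # w"] by simp
      then show ?thesis
        using len by (intro exI[of _ ?l]) simp
    qed
    then show ?thesis using True by auto
  next
    case False
    have "(\<forall>p < length ?s + x. p < (?s @ replicate x ?l) ! p) \<longleftrightarrow> (\<forall>p < length ?s. p < ?s ! p)"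
      if le: "length ?s + x \<le> ?l"
      using le by (auto simp: nth_append)
    then show ?thesis using False Cons.IH[of "a - 1 + x"] by auto
  qed
qed simp

text \<open>Leading zeros leave no trace, so the length must be fixed; then the first letter is the
  multiplicity of the greatest admissible value.\<close>

lemma inj_word_seq: "length w = length w' \<Longrightarrow> word_seq w = word_seq w' \<Longrightarrow> w = w'"
proof (induction w w' rule: list_induct2)
  case (Cons x w x' w')
  have f: "filter (\<lambda>i. i < length w) (word_seq w @ replicate y (length w)) = word_seq w"
    if "length v = length w" for y and w v :: "nat list"
    by (simp add: filter_id_conv word_seq_less)
  have "word_seq w = word_seq w'"
    using arg_cong[OF Cons.prems, of "filter (\<lambda>i. i < length w)"] f[of w w x] f[of w' w' x'] Cons.hyps
    by simp
  then have "w = w'" "replicate x (length w) = replicate x' (length w)"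
    using Cons by simp_all
  then show ?case by simp
qed simp

lemma surj_word_seq:
  "sorted xs \<Longrightarrow> set xs \<subseteq> {..<m} \<Longrightarrow> \<exists>w. length w = m \<and> word_seq w = xs"
proof (induction m arbitrary: xs)
  case (Suc m)
  \<comment> \<open>The entries equal to \<open>m\<close>, the greatest value allowed, form the
    block of the first letter; the smaller ones come from the rest of the word.\<close>
  let ?f = "filter (\<lambda>i. i < m) xs" and ?g = "filter (\<lambda>i. \<not> i < m) xs"
  obtain w where w: "length w = m" "word_seq w = ?f"
    using Suc.IH[of ?f] Suc.prems by (auto simp: sorted_wrt_filter)
  have g: "replicate (length ?g) m = ?g"
    by (rule replicate_eqI[symmetric]) (use Suc.prems in auto)
  have "?f @ ?g = xs"
    using Suc.prems(1)
  proof (induction xs)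
    case (Cons x xs)
    then show ?case
    proof (cases "x < m")
      case False
      then have "\<forall>y\<in>set xs. \<not> y < m" using Cons.prems by fastforce
      then show ?thesis using False by (simp add: filter_empty_conv filter_id_conv)
    qed simp
  qed simp
  then show ?case
    using w g by (intro exI[of _ "length ?g # w"]) simp
qed simp

lemma bij_betw_word_seq:
  assumes "m > 0"
  shows "bij_betw word_seq {w. good_word 1 w \<and> length w = Suc m} (E_seqs m)"
  unfolding bij_betw_def
proof
  show "inj_on word_seq {w. good_word 1 w \<and> length w = Suc m}"
    by (auto intro!: inj_onI inj_word_seq)
  show "word_seq ` {w. good_word 1 w \<and> length w = Suc m} = E_seqs m"
  proof (intro equalityI subsetI)
    fix xs assume "xs \<in> word_seq ` {w. good_word 1 w \<and> length w = Suc m}"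
    then obtain w where w: "good_word 1 w" "length w = Suc m" and xs: "xs = word_seq w"
      by blast
    then have len: "length xs = m" and gt: "\<And>p. p < m \<Longrightarrow> p < xs ! p"
      using good_word_iff_word_seq[of 1 w] by auto
    have "\<forall>i\<in>set xs. 0 < i"
      using gt len by (metis in_set_conv_nth gr_zeroI not_less0)
    moreover have "p \<le> xs ! (p - 1)" if "p \<in> {1..m - 1}" for p
      using gt[of "p - 1"] that assms by force
    moreover have "xs ! (m - 1) \<in> set xs" using assms len by simp
    \<comment> \<open>The value exceeds \<open>m - 1\<close>, and every value is less than the
      length \<open>m + 1\<close> of the word.\<close>
    then have "xs ! (m - 1) = m"
      using gt[of "m - 1"] word_seq_less[of "xs ! (m - 1)" w] assms w xs by simp
    ultimately show "xs \<in> E_seqs m"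
      using len xs sorted_word_seq by (simp add: E_seqs_def)
  next
    fix xs assume xs: "xs \<in> E_seqs m"
    have last: "xs ! p \<le> m" if "p < m" for p
      using xs that sorted_nth_mono[of xs p "m - 1"] by (auto simp: E_seqs_def)
    then have "set xs \<subseteq> {..<Suc m}"
      using xs by (auto simp: E_seqs_def in_set_conv_nth less_Suc_eq_le)
    then obtain w where w: "length w = Suc m" "word_seq w = xs"
      using surj_word_seq[of xs "Suc m"] xs by (auto simp: E_seqs_def)
    \<comment> \<open>With indices from 0, the bound \<open>i_p \<ge> p\<close> becomes strict. The
      last index is separate, since \<open>E_seqs\<close> prescribes its value instead of a
      bound.\<close>
    have "p < xs ! p" if "p < m" for p
    proof (cases "p = m - 1")
      case False
      then have "Suc p \<in> {1..m - 1}" using that by auto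
      then have "Suc p \<le> xs ! (Suc p - 1)" using xs unfolding E_seqs_def by blast
      then show ?thesis by simp
    qed (use xs that in \<open>auto simp: E_seqs_def\<close>)
    then have "good_word 1 w"
      using w xs by (simp add: good_word_iff_word_seq E_seqs_def)
    then show "xs \<in> word_seq ` {w. good_word 1 w \<and> length w = Suc m}"
      using w by blast
  qed
qed

section \<open>Counting trees and forests by type\<close>

lemma decreasing_list_eq_iff:
  assumes "sorted_wrt (\<ge>) p"
  shows "decreasing_list M = p \<longleftrightarrow> M = mset p"
proof
  assume "M = mset p"
  moreover have "sort p = rev p"
    by (rule properties_for_sort) (use assms in \<open>simp_all add: sorted_wrt_rev\<close>)
  ultimately show "decreasing_list M = p"
    by (simp add: decreasing_list_def)
next
  assume "decreasing_list M = p"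
  then show "M = mset p"
    by (auto simp: decreasing_list_def)
qed

text \<open>The bijection via Lukasiewicz words carries the degrees of a tree to the multiplicities
  of a sequence.\<close>

lemma RC_eq_card_trees:
  assumes p: "integer_partition m p" and "m > 0"
  shows "RC p = card {t. degrees t = mset p}"
proof -
  let ?f = "word_seq \<circ> word"
  have bij: "bij_betw ?f {t. edges t = m} (E_seqs m)"
    using bij_betw_word bij_betw_word_seq[OF \<open>m > 0\<close>] by (rule bij_betw_trans)
  have type: "seq_type (?f t) = p \<longleftrightarrow> degrees t = mset p" for t
    using p word_seq_type[of "word t"]
    by (simp add: seq_type_def decreasing_list_eq_iff integer_partition_def degrees_word)
  have "bij_betw ?f {t \<in> {t. edges t = m}. degrees t = mset p} {xs \<in> E_seqs m. seq_type xs = p}"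
    (is "bij_betw _ ?T _")
    unfolding bij_betw_def
  proof
    show "inj_on ?f {t \<in> {t. edges t = m}. degrees t = mset p}"
      using bij by (auto simp: bij_betw_def intro: inj_on_subset)
    show "?f ` {t \<in> {t. edges t = m}. degrees t = mset p} = {xs \<in> E_seqs m. seq_type xs = p}"
      unfolding bij_betw_imp_surj_on[OF bij, symmetric] type[symmetric] by blast
  qed
  then have "card ?T = card {xs \<in> E_seqs m. seq_type xs = p}"
    by (rule bij_betw_same_card)
  moreover have "?T = {t. degrees t = mset p}"
    using p by (auto simp: integer_partition_def sum_mset_sum_list simp flip: sum_mset_degrees)
  ultimately show ?thesis
    using p by (simp add: RC_def integer_partition_def)
qed

lemma set_listset: "xs \<in> listset As \<longleftrightarrow> list_all2 (\<in>) xs As"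
  by (induction As arbitrary: xs) (auto simp: set_Cons_def list_all2_Cons2)

lemma card_listset: "card (listset As) = prod_list (map card As)"
proof (induction As)
  case (Cons A As)
  have "listset (A # As) = (\<lambda>(x, xs). x # xs) ` (A \<times> listset As)"
    by (auto simp: set_Cons_def)
  moreover have "inj_on (\<lambda>(x, xs). x # xs) (A \<times> listset As)"
    by (auto simp: inj_on_def)
  ultimately show ?case
    using Cons by (simp add: card_image card_cartesian_product)
qed simp

text \<open>Forests are grouped by the list of types of their trees. The fibre over
  \<open>ps\<close> is a Cartesian product whose factors are counted by \<open>RC\<close>.\<close>

lemma sum_RC_eq_card_forests:
  assumes "0 \<notin> set mu"
  shows "(\<Sum>ps \<in> refinements lam mu. prod_list (map RC ps)) = card (forests mu (mset lam))"
proof -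
  let ?type = "map (\<lambda>t. decreasing_list (degrees t))"
  have mset_dl: "mset (decreasing_list M) = M" for M
    by (simp add: decreasing_list_def)
  have part: "integer_partition (edges t) (decreasing_list (degrees t))" for t
    unfolding integer_partition_def sum_list_decreasing_list sum_mset_degrees
    using zero_notin_degrees[of t] sorted_sorted_list_of_multiset[of "degrees t"]
    by (simp add: decreasing_list_def sorted_wrt_rev)
  have type: "?type ts \<in> refinements lam mu" if ts: "ts \<in> forests mu (mset lam)" for ts
  proof -
    have "mset (concat (?type ts)) = forest_degrees ts"
      by (induction ts) (auto simp: mset_dl)
    then show ?thesis
      using ts part by (auto simp: refinements_def forests_def)
  qed
  have fibre: "card {ts \<in> forests mu (mset lam). ?type ts = ps} = prod_list (map RC ps)"
    if ps: "ps \<in> refinements lam mu" for ps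
  proof -
    have len: "length ps = length mu"
      and pt: "\<And>i. i < length mu \<Longrightarrow> integer_partition (mu ! i) (ps ! i)"
      and un: "mset (concat ps) = mset lam"
      using ps by (auto simp: refinements_def)
    have dl: "decreasing_list (degrees t) = ps ! i \<longleftrightarrow> degrees t = mset (ps ! i)"
      if "i < length mu" for i t
      using pt[OF that] by (simp add: integer_partition_def decreasing_list_eq_iff)
    have "{ts \<in> forests mu (mset lam). ?type ts = ps} = listset (map (\<lambda>p. {t. degrees t = mset p}) ps)"
    proof (intro equalityI subsetI)
      fix ts assume "ts \<in> {ts \<in> forests mu (mset lam). ?type ts = ps}"
      then show "ts \<in> listset (map (\<lambda>p. {t. degrees t = mset p}) ps)"
        by (auto simp: set_listset list_all2_conv_all_nth mset_dl)
    next
      fix ts assume "ts \<in> listset (map (\<lambda>p. {t. degrees t = mset p}) ps)"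
      then have l: "length ts = length mu"
        and d: "\<And>i. i < length mu \<Longrightarrow> degrees (ts ! i) = mset (ps ! i)"
        by (auto simp: set_listset list_all2_conv_all_nth len)
      have "edges (ts ! i) = mu ! i" if "i < length mu" for i
        using pt[OF that] d[OF that]
        by (simp add: sum_mset_degrees[symmetric] integer_partition_def sum_mset_sum_list)
      then have e: "map edges ts = mu" using l by (auto intro: nth_equalityI)
      have "decreasing_list (degrees (ts ! i)) = ps ! i" if "i < length mu" for i
        using dl[OF that] d[OF that] by blast
      then have ty: "?type ts = ps"
        by (intro nth_equalityI[of "?type ts" ps]) (simp_all add: l len)
      have "forest_degrees ts = mset (concat (?type ts))"
        by (induction ts) (auto simp: mset_dl)
      then show "ts \<in> {ts \<in> forests mu (mset lam). ?type ts = ps}"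
        using e ty un by (simp add: forests_def)
    qed
    then have "card {ts \<in> forests mu (mset lam). ?type ts = ps} =
        prod_list (map (\<lambda>p. card {t. degrees t = mset p}) ps)"
      by (simp add: card_listset comp_def)
    also have "map (\<lambda>p. card {t. degrees t = mset p}) ps = map RC ps"
    proof (rule nth_equalityI)
      fix i assume "i < length (map (\<lambda>p. card {t. degrees t = mset p}) ps)"
      then have i: "i < length mu" using len by simp
      then have "mu ! i > 0" using assms by (metis gr0I nth_mem)
      then show "map (\<lambda>p. card {t. degrees t = mset p}) ps ! i = map RC ps ! i"
        using RC_eq_card_trees[OF pt[OF i]] i len by simp
    qed simp
    finally show ?thesis .
  qed
  have "forests mu (mset lam) = (\<Union>ps\<in>refinements lam mu. {ts \<in> forests mu (mset lam). ?type ts = ps})"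
    using type by auto
  also have "card \<dots> = (\<Sum>ps\<in>refinements lam mu. card {ts \<in> forests mu (mset lam). ?type ts = ps})"
    by (rule card_UN_disjoint) (auto simp: finite_refinements finite_forests)
  finally show ?thesis using fibre by simp
qed


subsection \<open>Cycle decompositions\<close>

text \<open>Each cycle is a list on which \<open>p\<close> acts as the cyclic shift, so splitting
  and merging become list operations. A fixed point is a list of length one; the set covered is
  prescribed separately through \<open>set (concat css)\<close>.\<close>

definition cycles_of :: "('a \<Rightarrow> 'a) \<Rightarrow> 'a list list \<Rightarrow> bool" where
  "cycles_of p css \<longleftrightarrow> distinct (concat css) \<and> (\<forall>c\<in>set css. c \<noteq> [] \<and> map p c = rotate1 c)"

lemma cycles_of_Nil [simp]: "cycles_of p []"
  by (simp add: cycles_of_def)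

lemma cycles_of_Cons:
  "cycles_of p (c # css) \<longleftrightarrow>
    c \<noteq> [] \<and> distinct c \<and> map p c = rotate1 c \<and> set c \<inter> set (concat css) = {} \<and> cycles_of p css"
  by (auto simp: cycles_of_def)

lemma cycles_of_move: "cycles_of p (as @ c # bs) \<longleftrightarrow> cycles_of p (c # as @ bs)"
  by (auto simp: cycles_of_def)

lemma cycles_of_rotate:
  assumes "cycles_of p (c # css)"
  shows "cycles_of p (rotate k c # css)"
  using assms by (simp add: cycles_of_Cons rotate1_rotate_swap flip: rotate_map)

text \<open>A cycle may be written starting anywhere and the cycles may be listed in any order, so
  \<open>t\<close> can be put at the end of the first.\<close>

lemma cycles_of_front:
  assumes "cycles_of p css" "t \<in> set (concat css)"
  obtains xs css' where "cycles_of p ((xs @ [t]) # css')"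
    and "mset (map length ((xs @ [t]) # css')) = mset (map length css)"
    and "set (concat ((xs @ [t]) # css')) = set (concat css)"
proof -
  obtain c where c: "c \<in> set css" "t \<in> set c" using assms(2) by auto
  obtain as bs where css: "css = as @ c # bs" using split_list[OF c(1)] by blast
  obtain us vs where "c = us @ t # vs" using split_list[OF c(2)] by blast
  then have cc: "c = (us @ [t]) @ vs" by simp
  have "rotate (length (us @ [t])) c = vs @ us @ [t]"
    unfolding cc by (subst rotate_append) simp
  then have "cycles_of p (((vs @ us) @ [t]) # as @ bs)"
    using assms(1) css cycles_of_move cycles_of_rotate by (metis append_assoc)
  then show thesis
    by (rule that) (auto simp: css cc)
qed

text \<open>The product exchanges only the images of \<open>s\<close> and \<open>t\<close>. In the
  long cycle these are the heads of \<open>ys @ [t]\<close> and \<open>xs @ [s]\<close>, so each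
  block closes up. One direction merges two cycles, the other splits one.\<close>

lemma cycles_of_transpose:
  "cycles_of (p \<circ> transpose s t) ((xs @ [s]) # (ys @ [t]) # css) \<longleftrightarrow>
    cycles_of p ((xs @ s # ys @ [t]) # css)"
proof -
  have dist: "distinct (concat ((xs @ [s]) # (ys @ [t]) # css)) \<longleftrightarrow>
      distinct (concat ((xs @ s # ys @ [t]) # css))"
    by auto
  have "(\<forall>c\<in>set ((xs @ [s]) # (ys @ [t]) # css). map (p \<circ> transpose s t) c = rotate1 c) \<longleftrightarrow>
      (\<forall>c\<in>set ((xs @ s # ys @ [t]) # css). map p c = rotate1 c)"
    if "distinct (concat ((xs @ s # ys @ [t]) # css))"
  proof -
    have eq: "map (p \<circ> transpose s t) zs = map p zs" if "s \<notin> set zs" "t \<notin> set zs" for zs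
      using that by (auto simp: transpose_def)
    have xs: "map (p \<circ> transpose s t) (xs @ [s]) = map p xs @ [p t]"
      using eq[of xs] that by auto
    have ys: "map (p \<circ> transpose s t) (ys @ [t]) = map p ys @ [p s]"
      using eq[of ys] that by auto
    have css: "map (p \<circ> transpose s t) c = map p c" if "c \<in> set css" for c
      using that \<open>distinct (concat ((xs @ s # ys @ [t]) # css))\<close> by (intro eq) auto
    \<comment> \<open>Naming the heads treats empty and nonempty \<open>xs\<close> and
      \<open>ys\<close> alike.\<close>
    obtain a as where a: "xs @ [s] = a # as" by (cases xs) auto
    obtain b bs where b: "ys @ [t] = b # bs" by (cases ys) auto
    have len: "length as = length xs" "length bs = length ys"
      using arg_cong[OF a, of length] arg_cong[OF b, of length] by simp_all
    have "xs @ s # ys @ [t] = a # as @ b # bs"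
      using a b by (metis append_Cons append_Nil append_assoc)
    then have rot: "rotate1 (xs @ s # ys @ [t]) = as @ b # bs @ [a]" by simp
    have rot_xs: "rotate1 (xs @ [s]) = as @ [a]" and rot_ys: "rotate1 (ys @ [t]) = bs @ [b]"
      unfolding a b by simp_all
    have map: "map p (xs @ s # ys @ [t]) = map p xs @ p s # map p ys @ [p t]" by simp
    from len have "map p (xs @ s # ys @ [t]) = rotate1 (xs @ s # ys @ [t]) \<longleftrightarrow>
        map p xs @ [p t] = rotate1 (xs @ [s]) \<and> map p ys @ [p s] = rotate1 (ys @ [t])"
      unfolding map rot rot_xs rot_ys by auto
    moreover have "(\<forall>c\<in>set css. map (p \<circ> transpose s t) c = rotate1 c) \<longleftrightarrow>
        (\<forall>c\<in>set css. map p c = rotate1 c)"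
      by (intro ball_cong refl) (simp only: css)
    ultimately show ?thesis
      by (simp only: list.set ball_simps xs ys) blast
  qed
  moreover have "(\<forall>c\<in>set ((xs @ [s]) # (ys @ [t]) # css). c \<noteq> []) \<longleftrightarrow>
      (\<forall>c\<in>set ((xs @ s # ys @ [t]) # css). c \<noteq> [])"
    by simp
  ultimately show ?thesis
    unfolding cycles_of_def dist ball_conj_distrib by blast
qed

section \<open>Cycle lengths and orbits\<close>

lemma cycles_of_funpow:
  assumes "map p c = rotate1 c"
  shows "map (p ^^ k) c = rotate k c"
proof (induction k)
  case (Suc k)
  have "map (p ^^ Suc k) c = map p (map (p ^^ k) c)" by simp
  also have "\<dots> = rotate k (map p c)" using Suc by (simp add: rotate_map)
  finally show ?case by (simp only: assms rotate1_rotate_swap rotate_Suc)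
qed simp

lemma orbit_cycles_of:
  assumes "map p c = rotate1 c" "x \<in> set c"
  shows "orbit p x = set c"
proof -
  obtain i where i: "i < length c" "c ! i = x" using assms(2) by (auto simp: in_set_conv_nth)
  have pow: "(p ^^ k) x = c ! ((k + i) mod length c)" for k
    using arg_cong[OF cycles_of_funpow[OF assms(1), of k], of "\<lambda>l. l ! i"] i
    by (simp add: nth_rotate)
  show ?thesis
  proof (intro equalityI subsetI)
    fix y assume "y \<in> orbit p x"
    then show "y \<in> set c"
      using i by (auto simp: orbit_altdef pow intro!: nth_mem mod_less_divisor)
  next
    fix y assume "y \<in> set c"
    then obtain j where j: "j < length c" "c ! j = y" by (auto simp: in_set_conv_nth)
    \<comment> \<open>Orbits use positive powers only; adding a full turn \<open>length c\<close>
      keeps the exponent positive.\<close>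
    have "(p ^^ (j + length c - i)) x = y"
      using i j by (simp add: pow)
    moreover have "0 < j + length c - i" using i by simp
    ultimately show "y \<in> orbit p x" unfolding orbit_altdef by blast
  qed
qed

text \<open>All points of a cycle have its underlying set as orbit, and different cycles have
  different sets. Hence the multiset of cycle lengths depends only on \<open>p\<close> and the set
  covered.\<close>

lemma cycles_of_orbits:
  assumes "cycles_of p css"
  shows "mset (map length css) = image_mset card (mset_set (orbit p ` set (concat css)))"
proof -
  have "orbit p ` set (concat css) = (\<Union>c\<in>set css. orbit p ` set c)" by auto
  also have "\<dots> = (\<Union>c\<in>set css. {set c})"
  proof (rule SUP_cong)
    fix c assume "c \<in> set css"
    then have "c \<noteq> []" "map p c = rotate1 c" using assms by (auto simp: cycles_of_def)
    then have "orbit p ` set c = (\<lambda>x. set c) ` set c"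
      by (intro image_cong orbit_cycles_of) auto
    then show "orbit p ` set c = {set c}"
      using \<open>c \<noteq> []\<close> by (simp add: image_constant_conv)
  qed simp
  also have "\<dots> = set (map set css)" by auto
  finally have "mset_set (orbit p ` set (concat css)) = mset_set (set (map set css))" by simp
  also have "\<dots> = mset (map set css)"
  proof (rule mset_set_set)
    show "distinct (map set css)"
      using assms
    proof (induction css)
      case (Cons c css)
      have "set c \<noteq> set d" if "d \<in> set css" for d
      proof
        assume "set c = set d"
        then have "set c \<subseteq> set (concat css)" using that by auto
        moreover have "set c \<inter> set (concat css) = {}" "c \<noteq> []"
          using Cons.prems by (simp_all add: cycles_of_Cons)
        ultimately show False by (metis inf.absorb1 set_empty)
      qed
      then show ?case using Cons.IH Cons.prems by (simp add: cycles_of_Cons image_iff)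
    qed simp
  qed
  also have "image_mset card \<dots> = mset (map length css)"
    using assms by (induction css) (auto simp: cycles_of_Cons distinct_card)
  finally show ?thesis by simp
qed

section \<open>Bounding the number of transpositions from below\<close>

lemma cycles_of_merge:
  assumes p: "cycles_of p ((xs @ [t]) # css)" and s: "s \<in> set (concat css)"
  obtains css' where "cycles_of (p \<circ> transpose s t) css'" "length css' = length css"
    "set (concat css') = set (concat ((xs @ [t]) # css))"
proof -
  have "cycles_of p css" using p by (simp add: cycles_of_Cons)
  then obtain ys css' where ys: "cycles_of p ((ys @ [s]) # css')"
    "mset (map length ((ys @ [s]) # css')) = mset (map length css)"
    "set (concat ((ys @ [s]) # css')) = set (concat css)"
    using s by (rule cycles_of_front)
  have "cycles_of p ((xs @ [t]) # (ys @ [s]) # css')"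
    using p ys(1,3) by (simp add: cycles_of_Cons[of _ "xs @ [t]"])
  \<comment> \<open>A transposition is its own inverse, so \<open>cycles_of_transpose\<close> can be
    applied to the new map and read as merging.\<close>
  moreover have "p = (p \<circ> transpose s t) \<circ> transpose t s"
    by (simp add: transpose_commute o_assoc[symmetric])
  ultimately have "cycles_of (p \<circ> transpose s t) ((xs @ t # ys @ [s]) # css')"
    using cycles_of_transpose by metis
  moreover have "length ((xs @ t # ys @ [s]) # css') = length css"
    using ys(2) by (metis length_Cons length_map size_mset)
  moreover have "set (concat ((xs @ t # ys @ [s]) # css')) = set (concat ((xs @ [t]) # css))"
    using ys(3) by auto
  ultimately show thesis by (rule that)
qed

text \<open>The identity has \<open>card S\<close> cycles, and each further factor splits one cycle
  or merges two, so the number of cycles drops by at most one.\<close>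

lemma ex_cycles_of_apply_transps:
  assumes "finite S" "\<forall>(a, b)\<in>set fs. a \<noteq> b \<and> a \<in> S \<and> b \<in> S"
  shows "\<exists>css. cycles_of (apply_transps fs) css \<and> set (concat css) = S \<and>
    card S \<le> length css + length fs"
  using assms(2)
proof (induction fs rule: rev_induct)
  case Nil
  obtain l where l: "set l = S" "distinct l" using assms(1) finite_distinct_list by blast
  have "cycles_of id (map (\<lambda>x. [x]) l)"
    using l(2) by (auto simp: cycles_of_def concat_map_singleton)
  then show ?case
    using l by (intro exI[of _ "map (\<lambda>x. [x]) l"]) (auto simp: distinct_card id_def)
next
  case (snoc f fs)
  obtain s t where f: "f = (s, t)" by (cases f)
  let ?p = "apply_transps fs"
  obtain css where css: "cycles_of ?p css" "set (concat css) = S" "card S \<le> length css + length fs"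
    using snoc by auto
  have st: "s \<noteq> t" "s \<in> S" "t \<in> S" using snoc.prems f by auto
  obtain xs css1 where front: "cycles_of ?p ((xs @ [t]) # css1)"
    "mset (map length ((xs @ [t]) # css1)) = mset (map length css)"
    "set (concat ((xs @ [t]) # css1)) = set (concat css)"
    using css(1) by (rule cycles_of_front[of _ _ t]) (use st css in simp)
  have len: "length css = Suc (length css1)"
    using front(2) by (metis length_Cons length_map size_mset)
  have eq: "apply_transps (fs @ [f]) = ?p \<circ> transpose s t"
    by (simp add: f)
  show ?case
  proof (cases "s \<in> set xs")
    case True
    then obtain us vs where xs: "xs = us @ s # vs" using split_list by fastforce
    then have "cycles_of (?p \<circ> transpose s t) ((us @ [s]) # (vs @ [t]) # css1)"
      using front(1) by (simp add: cycles_of_transpose)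
    moreover have "set (concat ((us @ [s]) # (vs @ [t]) # css1)) = S"
      using css(2) front(3) xs by auto
    moreover have "card S \<le> length ((us @ [s]) # (vs @ [t]) # css1) + length (fs @ [f])"
      using css(3) len by simp
    ultimately show ?thesis
      unfolding eq by blast
  next
    case False
    then have "s \<in> set (concat css1)" using st css(2) front(3) by auto
    with front(1) obtain css' where "cycles_of (?p \<circ> transpose s t) css'" "length css' = length css1"
      "set (concat css') = set (concat ((xs @ [t]) # css1))"
      by (rule cycles_of_merge)
    moreover from this have "set (concat css') = S" "card S \<le> length css' + length (fs @ [f])"
      using css front(3) len by simp_all
    ultimately show ?thesis
      unfolding eq by blast
  qed
qed

text \<open>The number of cycles is the number of orbits, so the bound passes from one decomposition
  to every other.\<close>

lemma card_le_cycles_of_apply_transps: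
  assumes "finite S" "\<forall>(a, b)\<in>set fs. a \<noteq> b \<and> a \<in> S \<and> b \<in> S"
    and "cycles_of (apply_transps fs) css" "set (concat css) = S"
  shows "card S \<le> length css + length fs"
proof -
  obtain css' where css': "cycles_of (apply_transps fs) css'" "set (concat css') = S"
    "card S \<le> length css' + length fs"
    using ex_cycles_of_apply_transps[OF assms(1,2)] by blast
  have "mset (map length css) = mset (map length css')"
    using cycles_of_orbits[OF assms(3)] cycles_of_orbits[OF css'(1)] assms(4) css'(2) by simp
  then have "length css = length css'" by (metis length_map size_mset)
  then show ?thesis using css'(3) by simp
qed

subsection \<open>Stripping the last transposition\<close>

definition exponents :: "nat \<Rightarrow> (nat \<times> nat) list \<Rightarrow> nat multiset" where
  "exponents n fs = (\<Sum>j\<in>{1..n}. nonzero (count_list (map snd fs) j))"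

definition factorizations :: "nat \<Rightarrow> (nat \<Rightarrow> nat) \<Rightarrow> nat multiset \<Rightarrow> (nat \<times> nat) list set" where
  "factorizations n p M = {fs. primitive_factorization n p fs \<and> exponents n fs = M}"

text \<open>
  Here \<open>b\<close> transpositions of the form \<open>(*, n + 1)\<close> have already been stripped off from the right
  end; they still count towards the type.
\<close>

definition partial_factorizations ::
    "nat \<Rightarrow> nat \<Rightarrow> (nat \<Rightarrow> nat) \<Rightarrow> nat multiset \<Rightarrow> (nat \<times> nat) list set" where
  "partial_factorizations n b p M = {fs. primitive_factorization (Suc n) p fs \<and>
     nonzero (b + count_list (map snd fs) (Suc n)) + exponents n fs = M}"

lemma factorizations_Suc: "factorizations (Suc n) p M = partial_factorizations n 0 p M"
  by (simp add: factorizations_def partial_factorizations_def exponents_def add.commute)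

lemma sum_mset_sum: "sum_mset (\<Sum>j\<in>A. f j) = (\<Sum>j\<in>A. sum_mset (f j))"
  for f :: "'a \<Rightarrow> 'b::comm_monoid_add multiset"
  by (induction A rule: infinite_finite_induct) auto

lemma length_partial_factorization:
  assumes "fs \<in> partial_factorizations n b p M"
  shows "sum_mset M = b + length fs"
proof -
  have sub: "set (map snd fs) \<subseteq> {1..Suc n}"
    using assms by (fastforce simp: partial_factorizations_def primitive_factorization_def)
  have "sum_mset M = b + count_list (map snd fs) (Suc n) + (\<Sum>j\<in>{1..n}. count_list (map snd fs) j)"
    using assms by (auto simp: partial_factorizations_def exponents_def sum_mset_sum)
  also have "\<dots> = b + (\<Sum>j\<in>{1..Suc n}. count_list (map snd fs) j)"
    by simp
  also have "\<dots> = b + length fs"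
    using sum_count_set[OF sub] by simp
  finally show ?thesis .
qed

lemma finite_partial_factorizations: "finite (partial_factorizations n b p M)"
proof (rule finite_subset)
  show "partial_factorizations n b p M \<subseteq>
      {fs. set fs \<subseteq> {0..Suc n} \<times> {0..Suc n} \<and> length fs = sum_mset M - b}"
  proof
    fix fs assume fs: "fs \<in> partial_factorizations n b p M"
    then have "set fs \<subseteq> {0..Suc n} \<times> {0..Suc n}"
      by (fastforce simp: partial_factorizations_def primitive_factorization_def)
    then show "fs \<in> {fs. set fs \<subseteq> {0..Suc n} \<times> {0..Suc n} \<and> length fs = sum_mset M - b}"
      using length_partial_factorization[OF fs] by simp
  qed
qed (simp add: finite_lists_length_eq)

lemma primitive_factorization_snoc_iff:
  "primitive_factorization (Suc n) p (gs @ [(s, Suc n)]) \<longleftrightarrow>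
    1 \<le> s \<and> s \<le> n \<and> primitive_factorization (Suc n) (p \<circ> transpose s (Suc n)) gs"
proof -
  have "apply_transps gs \<circ> transpose s (Suc n) = p \<longleftrightarrow> apply_transps gs = p \<circ> transpose s (Suc n)"
    by (auto simp: o_assoc[symmetric])
  moreover have "apply_transps (gs @ [(s, Suc n)]) = apply_transps gs \<circ> transpose s (Suc n)"
    by simp
  ultimately show ?thesis
    unfolding primitive_factorization_def by (auto simp: sorted_append)
qed

text \<open>Stripping one factor raises \<open>b\<close> by one and lowers the count of
  \<open>Suc n\<close> by one, so their sum and hence \<open>M\<close> stay fixed.\<close>

lemma partial_factorizations_snoc_iff:
  "gs @ [(s, Suc n)] \<in> partial_factorizations n b p M \<longleftrightarrow>
    1 \<le> s \<and> s \<le> n \<and> gs \<in> partial_factorizations n (Suc b) (p \<circ> transpose s (Suc n)) M"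
proof -
  have "exponents n (gs @ [(s, Suc n)]) = exponents n gs"
    unfolding exponents_def by (intro sum.cong) auto
  then show ?thesis
    by (simp add: partial_factorizations_def primitive_factorization_snoc_iff)
qed

text \<open>As the second entries increase weakly, \<open>Suc n\<close> can occur among them only if
  the last factor has it.\<close>

lemma primitive_factorization_last_cases:
  assumes "primitive_factorization (Suc n) p fs"
  obtains (small) "primitive_factorization n p fs" "count_list (map snd fs) (Suc n) = 0"
  | (snoc) gs s where "fs = gs @ [(s, Suc n)]"
proof (cases "\<forall>(s, t)\<in>set fs. t \<le> n")
  case True
  show ?thesis
  proof (rule small)
    show "primitive_factorization n p fs"
      using True assms by (auto simp: primitive_factorization_def)
    show "count_list (map snd fs) (Suc n) = 0"
      by (rule count_notin) (use True in auto)
  qed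
next
  case False
  then obtain s t where st: "(s, t) \<in> set fs" "n < t" by force
  have le: "snd f \<le> Suc n" if "f \<in> set fs" for f
    using assms that by (auto simp: primitive_factorization_def)
  obtain gs g where fs: "fs = gs @ [g]" using st(1) by (cases fs rule: rev_cases) auto
  have "snd f \<le> snd g" if "f \<in> set fs" for f
    using assms that by (auto simp: fs primitive_factorization_def sorted_append)
  from this[OF st(1)] have "snd g = Suc n"
    using st(2) le[of g] fs by simp
  then show ?thesis using fs snoc[of gs "fst g"] by (metis prod.collapse)
qed

text \<open>
  By minimality, multiplying by the stripped transposition must split a cycle, not merge two.
\<close>

lemma last_transposition_in_cycle:
  assumes fs: "gs @ [(s, Suc n)] \<in> partial_factorizations n b p M"
    and p: "cycles_of p ((xs @ [Suc n]) # css)" "set (concat ((xs @ [Suc n]) # css)) = {1..Suc n}"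
    and min: "sum_mset M + length css = n + b"
  shows "s \<in> set xs"
proof (rule ccontr)
  assume "s \<notin> set xs"
  have s: "1 \<le> s" "s \<le> n"
    and gs: "gs \<in> partial_factorizations n (Suc b) (p \<circ> transpose s (Suc n)) M"
    using fs by (simp_all add: partial_factorizations_snoc_iff)
  have "s \<in> set (concat ((xs @ [Suc n]) # css))" unfolding p(2) using s by simp
  then have "s \<in> set (concat css)" using \<open>s \<notin> set xs\<close> s by auto
  with p(1) obtain css' where css': "cycles_of (p \<circ> transpose s (Suc n)) css'"
    "length css' = length css" "set (concat css') = set (concat ((xs @ [Suc n]) # css))"
    by (rule cycles_of_merge)
  have prim: "primitive_factorization (Suc n) (p \<circ> transpose s (Suc n)) gs"
    using gs by (simp add: partial_factorizations_def)
  \<comment> \<open>The assumption \<open>min\<close> leaves \<open>gs\<close> with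
    \<open>n - 1 - length css\<close> factors, while \<open>length css\<close> cycles on
    \<open>n + 1\<close> points require at least \<open>n + 1 - length css\<close>.\<close>
  have "card {1..Suc n} \<le> length css' + length gs"
  proof (rule card_le_cycles_of_apply_transps)
    show "\<forall>(a, b)\<in>set gs. a \<noteq> b \<and> a \<in> {1..Suc n} \<and> b \<in> {1..Suc n}"
      using prim by (fastforce simp: primitive_factorization_def)
    show "cycles_of (apply_transps gs) css'"
      using prim css'(1) by (simp add: primitive_factorization_def)
    show "set (concat css') = {1..Suc n}" using css'(3) p(2) by simp
  qed simp
  then show False
    using length_partial_factorization[OF gs] min css'(2) by simp
qed

text \<open>Factorizations are grouped by their last factor \<open>(s, Suc n)\<close>. Since
  \<open>css\<close> omits the cycle of \<open>Suc n\<close>, \<open>min\<close> says that the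
  \<open>n - length css\<close> remaining factors are as few as possible.\<close>

lemma card_partial_factorizations_step:
  assumes p: "cycles_of p ((xs @ [Suc n]) # css)" "set (concat ((xs @ [Suc n]) # css)) = {1..Suc n}"
    and min: "sum_mset M + length css = n + b" and "xs \<noteq> []"
  shows "card (partial_factorizations n b p M) =
    (\<Sum>j<length xs. card (partial_factorizations n (Suc b) (p \<circ> transpose (xs ! j) (Suc n)) M))"
proof -
  let ?F = "\<lambda>s. partial_factorizations n (Suc b) (p \<circ> transpose s (Suc n)) M"
  let ?G = "\<lambda>s. (\<lambda>gs. gs @ [(s, Suc n)]) ` ?F s"
  have dist: "distinct xs" "Suc n \<notin> set xs" using p(1) by (auto simp: cycles_of_Cons)
  have xs_sub: "set xs \<subseteq> {1..n}"
  proof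
    fix x assume "x \<in> set xs"
    then have "x \<in> {1..Suc n}" unfolding p(2)[symmetric] by simp
    then show "x \<in> {1..n}" using \<open>x \<in> set xs\<close> dist(2) by (auto simp: le_Suc_eq)
  qed
  \<comment> \<open>A factorization without factors \<open>(s, Suc n)\<close> would fix
    \<open>Suc n\<close>; hence the last factor has this form.\<close>
  have moved: "p (Suc n) \<noteq> Suc n"
  proof -
    obtain x xs' where "xs = x # xs'" using \<open>xs \<noteq> []\<close> by (cases xs) auto
    then have "map p xs @ [p (Suc n)] = (xs' @ [Suc n]) @ [x]"
      using p(1) by (simp add: cycles_of_Cons)
    then have "p (Suc n) = x" by (metis last_snoc)
    then show ?thesis using dist(2) \<open>xs = x # xs'\<close> by auto
  qed
  have "partial_factorizations n b p M = (\<Union>s\<in>set xs. ?G s)"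
  proof (intro equalityI subsetI)
    fix fs assume fs: "fs \<in> partial_factorizations n b p M"
    then have "primitive_factorization (Suc n) p fs" by (simp add: partial_factorizations_def)
    then show "fs \<in> (\<Union>s\<in>set xs. ?G s)"
    proof (cases rule: primitive_factorization_last_cases)
      case small
      then have "p permutes {1..n}"
        by (fastforce simp: primitive_factorization_def intro!: permutes_apply_transps)
      then show ?thesis using moved by (simp add: permutes_def)
    next
      case (snoc gs s)
      then have "s \<in> set xs"
        using last_transposition_in_cycle[OF _ p min] fs by blast
      then show ?thesis using fs snoc by (auto simp: partial_factorizations_snoc_iff)
    qed
  next
    fix fs assume "fs \<in> (\<Union>s\<in>set xs. ?G s)"
    then show "fs \<in> partial_factorizations n b p M"
      using xs_sub by (auto simp: partial_factorizations_snoc_iff)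
  qed
  also have "card \<dots> = (\<Sum>s\<in>set xs. card (?G s))"
    by (rule card_UN_disjoint) (auto simp: finite_partial_factorizations)
  also have "\<dots> = (\<Sum>s\<in>set xs. card (?F s))"
    by (rule sum.cong[OF refl], rule card_image) (simp add: inj_on_def)
  \<comment> \<open>Positions replace elements, because \<open>j\<close> determines the lengths of
    the two cycles after the split.\<close>
  also have "\<dots> = (\<Sum>j<length xs. card (?F (xs ! j)))"
    by (rule sum.reindex_bij_betw[OF bij_betw_nth[OF dist(1) refl refl], symmetric])
  finally show ?thesis .
qed

text \<open>
  The tree counterpart: \<open>b\<close> subtrees of the root that belongs to the cycle of \<open>n + 1\<close> have already
  been moved to \<open>ts\<close>, and \<open>r\<close> lists the remaining ones.
\<close>

definition partial_forests ::
    "nat \<Rightarrow> nat \<Rightarrow> nat list \<Rightarrow> nat multiset \<Rightarrow> (tree list \<times> tree list) set" where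
  "partial_forests b m es M = {(r, ts). edges (Node r) = m \<and> map edges ts = es \<and>
     nonzero (b + length r) + forest_degrees r + forest_degrees ts = M}"

lemma finite_partial_forests: "finite (partial_forests b m es M)"
proof -
  have "finite (Node -` {t. edges t = m})"
    by (intro finite_vimageI finite_trees) (simp add: inj_on_def)
  moreover have "finite {ts. set ts \<subseteq> (\<Union>e\<in>set es. {t. edges t = e}) \<and> length ts = length es}"
    by (intro finite_lists_length_eq finite_UN_I finite_set finite_trees)
  ultimately show ?thesis
    by (rule finite_subset[rotated, OF finite_cartesian_product]) (auto simp: partial_forests_def)
qed

text \<open>Detaching the first subtree, with \<open>j\<close> edges, also removes the edge above
  it: \<open>m - Suc j\<close> edges remain, and \<open>b + length r\<close> is unchanged. Splitting
  a cycle at \<open>xs ! j\<close> matches this, as it cuts off \<open>j + 1\<close> points.\<close>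

lemma card_partial_forests_step:
  assumes "m > 0"
  shows "card (partial_forests b m es M) =
    (\<Sum>j<m. card (partial_forests (Suc b) (m - Suc j) (j # es) M))"
proof -
  \<comment> \<open>This map undoes the detachment: it puts the first tree of \<open>ts\<close> back
    under the root.\<close>
  let ?f = "\<lambda>(r, ts). (hd ts # r, tl ts)"
  have "partial_forests b m es M =
      (\<Union>j<m. ?f ` partial_forests (Suc b) (m - Suc j) (j # es) M)"
  proof (intro equalityI subsetI)
    fix x assume "x \<in> partial_forests b m es M"
    then obtain r ts where x: "x = (r, ts)" and r: "edges (Node r) = m"
      and ts: "map edges ts = es" "nonzero (b + length r) + forest_degrees r + forest_degrees ts = M"
      by (auto simp: partial_forests_def)
    obtain t r' where r': "r = t # r'" using r assms by (cases r) auto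
    have "(r', t # ts) \<in> partial_forests (Suc b) (m - Suc (edges t)) (edges t # es) M"
      using r ts by (auto simp: partial_forests_def r' ac_simps)
    moreover have "edges t < m" using r r' by simp
    ultimately show "x \<in> (\<Union>j<m. ?f ` partial_forests (Suc b) (m - Suc j) (j # es) M)"
      by (auto simp: x r' intro!: bexI[of _ "edges t"] image_eqI[of _ _ "(r', t # ts)"])
  next
    fix x assume "x \<in> (\<Union>j<m. ?f ` partial_forests (Suc b) (m - Suc j) (j # es) M)"
    then show "x \<in> partial_forests b m es M"
      by (auto simp: partial_forests_def map_eq_Cons_conv ac_simps)
  qed
  also have "card \<dots> = (\<Sum>j<m. card (?f ` partial_forests (Suc b) (m - Suc j) (j # es) M))"
  proof (rule card_UN_disjoint)
    have "edges (hd (fst x)) = j"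
      if "x \<in> ?f ` partial_forests (Suc b) (m - Suc j) (j # es) M" for x j
      using that by (auto simp: partial_forests_def map_eq_Cons_conv)
    then show "\<forall>i\<in>{..<m}. \<forall>j\<in>{..<m}. i \<noteq> j \<longrightarrow>
        ?f ` partial_forests (Suc b) (m - Suc i) (i # es) M \<inter>
        ?f ` partial_forests (Suc b) (m - Suc j) (j # es) M = {}"
      by blast
  qed (simp_all add: finite_partial_forests)
  also have "\<dots> = (\<Sum>j<m. card (partial_forests (Suc b) (m - Suc j) (j # es) M))"
  proof (rule sum.cong[OF refl], rule card_image)
    fix j
    have "inj_on ?f {x. snd x \<noteq> []}"
      by (auto simp: inj_on_def neq_Nil_conv)
    then show "inj_on ?f (partial_forests (Suc b) (m - Suc j) (j # es) M)"
      by (rule inj_on_subset) (auto simp: partial_forests_def)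
  qed
  finally show ?thesis .
qed

lemma card_partial_forests_0:
  "card (partial_forests 0 m es M) = card (forests (m # es) M)"
proof -
  have "forests (m # es) M = (\<lambda>(r, ts). Node r # ts) ` partial_forests 0 m es M"
  proof (intro equalityI subsetI)
    fix ts assume "ts \<in> forests (m # es) M"
    then obtain t ts' where ts: "ts = t # ts'" and f: "t # ts' \<in> forests (m # es) M"
      by (auto simp: forests_def map_eq_Cons_conv)
    obtain r where "t = Node r" by (cases t)
    then have "(r, ts') \<in> partial_forests 0 m es M"
      using f by (simp add: forests_def partial_forests_def)
    then show "ts \<in> (\<lambda>(r, ts). Node r # ts) ` partial_forests 0 m es M"
      using ts \<open>t = Node r\<close> by (intro image_eqI[of _ _ "(r, ts')"]) auto
  qed (auto simp: forests_def partial_forests_def)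
  then show ?thesis
    by (simp add: card_image inj_on_def split_def prod_eq_iff)
qed

text \<open>With no edges left below the root, \<open>b\<close> is its final number of
  children.\<close>

lemma card_partial_forests_no_children:
  "card (partial_forests b 0 es M) =
    (if nonzero b \<subseteq># M then card (forests es (M - nonzero b)) else 0)"
proof -
  have "r = []" if "edges (Node r) = 0" for r using that by (cases r) auto
  then have "partial_forests b 0 es M =
      Pair [] ` {ts. map edges ts = es \<and> nonzero b + forest_degrees ts = M}"
    by (auto simp: partial_forests_def)
  then have "card (partial_forests b 0 es M) =
      card {ts. map edges ts = es \<and> nonzero b + forest_degrees ts = M}"
    by (simp add: card_image inj_on_def)
  also have "{ts. map edges ts = es \<and> nonzero b + forest_degrees ts = M} =
      (if nonzero b \<subseteq># M then forests es (M - nonzero b) else {})"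
    by (auto simp: forests_def)
  finally show ?thesis by simp
qed

lemma partial_factorizations_fixed:
  assumes p: "cycles_of p ([Suc n] # css)" "set (concat ([Suc n] # css)) = {1..Suc n}"
    and min: "sum_mset M + length css = n + b"
  shows "partial_factorizations n b p M =
    (if nonzero b \<subseteq># M then factorizations n p (M - nonzero b) else {})"
proof -
  have "fs \<in> partial_factorizations n b p M \<longleftrightarrow>
      primitive_factorization n p fs \<and> nonzero b + exponents n fs = M" for fs
  proof
    assume fs: "fs \<in> partial_factorizations n b p M"
    then have "primitive_factorization (Suc n) p fs" by (simp add: partial_factorizations_def)
    then show "primitive_factorization n p fs \<and> nonzero b + exponents n fs = M"
    proof (cases rule: primitive_factorization_last_cases)
      case (snoc gs s)
      \<comment> \<open>The cycle of \<open>Suc n\<close> has no other point here, so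
        \<open>s\<close> would have to lie in the empty list.\<close>
      then show ?thesis
        using last_transposition_in_cycle[of gs s n b p M "[]" css] fs p min by simp
    qed (use fs in \<open>simp add: partial_factorizations_def\<close>)
  next
    assume fs: "primitive_factorization n p fs \<and> nonzero b + exponents n fs = M"
    then have "Suc n \<notin> set (map snd fs)"
      by (fastforce simp: primitive_factorization_def)
    then have "count_list (map snd fs) (Suc n) = 0" by (rule count_notin)
    moreover have "primitive_factorization (Suc n) p fs"
      using fs by (fastforce simp: primitive_factorization_def)
    ultimately show "fs \<in> partial_factorizations n b p M"
      using fs by (simp add: partial_factorizations_def)
  qed
  moreover have "nonzero b + N = M \<longleftrightarrow> nonzero b \<subseteq># M \<and> N = M - nonzero b" for N
    by auto
  ultimately show ?thesis
    by (intro set_eqI) (simp add: factorizations_def)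
qed

text \<open>Both counts obey the same recursion on \<open>length xs\<close>. When \<open>xs\<close>
  is empty, \<open>Suc n\<close> is a fixed point and the hypothesis \<open>IH\<close> for
  \<open>n\<close> applies.\<close>

lemma card_partial_factorizations:
  assumes IH: "\<And>p css M. cycles_of p css \<Longrightarrow> set (concat css) = {1..n} \<Longrightarrow> p permutes {1..n} \<Longrightarrow>
      sum_mset M + length css = n \<Longrightarrow>
      card (factorizations n p M) = card (forests (map (\<lambda>c. length c - 1) css) M)"
    and p: "cycles_of p ((xs @ [Suc n]) # css)" "set (concat ((xs @ [Suc n]) # css)) = {1..Suc n}"
      "p permutes {1..Suc n}"
    and min: "sum_mset M + length css = n + b"
  shows "card (partial_factorizations n b p M) =
    card (partial_forests b (length xs) (map (\<lambda>c. length c - 1) css) M)"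
  using p min
proof (induction "length xs" arbitrary: xs p css b rule: less_induct)
  case less
  note p = less.prems(1-3) and min = less.prems(4)
  show ?case
  proof (cases "xs = []")
    case True
    have p': "cycles_of p ([Suc n] # css)" "set (concat ([Suc n] # css)) = {1..Suc n}"
      using p(1,2) True by simp_all
    have css: "cycles_of p css" "Suc n \<notin> set (concat css)" and fix_n: "p (Suc n) = Suc n"
      using p'(1) by (auto simp: cycles_of_Cons)
    have "set (concat css) = {1..Suc n} - {Suc n}"
      using p'(2) css(2) by auto
    then have set: "set (concat css) = {1..n}" by (simp add: atLeastAtMostSuc_conv)
    have "p permutes {1..n}"
      by (rule permutes_superset[OF p(3)]) (use fix_n in \<open>auto simp: le_Suc_eq\<close>)
    then have "card (factorizations n p (M - nonzero b)) =
        card (forests (map (\<lambda>c. length c - 1) css) (M - nonzero b))" if "nonzero b \<subseteq># M"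
    proof (rule IH[OF css(1) set])
      obtain N where "M = nonzero b + N"
        using \<open>nonzero b \<subseteq># M\<close> by (auto simp: mset_subset_eq_exists_conv)
      then show "sum_mset (M - nonzero b) + length css = n" using min by simp
    qed
    then show ?thesis
      using partial_factorizations_fixed[OF p' min] True by (simp add: card_partial_forests_no_children)
  next
    case False
    let ?es = "map (\<lambda>c. length c - 1) css"
    have "card (partial_factorizations n (Suc b) (p \<circ> transpose (xs ! j) (Suc n)) M) =
        card (partial_forests (Suc b) (length xs - Suc j) (j # ?es) M)" if j: "j < length xs" for j
    proof -
      let ?p = "p \<circ> transpose (xs ! j) (Suc n)"
      \<comment> \<open>The transposition splits off \<open>?l\<close>, of \<open>j + 1\<close>
        points, while \<open>?r\<close> is the new, shorter cycle of \<open>Suc n\<close>.\<close>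
      let ?l = "take j xs @ [xs ! j]" and ?r = "drop (Suc j) xs @ [Suc n]"
      have xs: "xs @ [Suc n] = take j xs @ xs ! j # ?r"
        using j by (simp add: id_take_nth_drop[of j xs, symmetric] flip: append_Cons append_assoc)
      have "cycles_of ?p (?l # ?r # css)"
        using p(1) unfolding xs cycles_of_transpose by simp
      then have "cycles_of ?p (?r # ?l # css)"
        using cycles_of_move[of ?p "[?l]"] by simp
      moreover have "set (concat (?r # ?l # css)) = {1..Suc n}"
        unfolding p(2)[symmetric] xs by auto
      moreover have "?p permutes {1..Suc n}"
      proof (rule permutes_compose[OF _ p(3)], rule permutes_swap_id)
        have "xs ! j \<in> set (concat ((xs @ [Suc n]) # css))" using j by simp
        then show "xs ! j \<in> {1..Suc n}" unfolding p(2) .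
      qed simp
      ultimately show ?thesis
        using less.hyps[of "drop (Suc j) xs" ?p "?l # css" "Suc b"] j min by simp
    qed
    then show ?thesis
      using card_partial_factorizations_step[OF p(1,2) min False] False
      by (simp add: card_partial_forests_step)
  qed
qed

text \<open>Induction on the greatest point: \<open>Suc n\<close> is rotated to the end of its
  cycle, and nothing has been stripped yet, so \<open>b\<close> starts at 0.\<close>

lemma card_factorizations:
  assumes "cycles_of p css" "set (concat css) = {1..n}" "p permutes {1..n}"
    and "sum_mset M + length css = n"
  shows "card (factorizations n p M) = card (forests (map (\<lambda>c. length c - 1) css) M)"
  using assms
proof (induction n arbitrary: p css M)
  case 0
  then have "p = id" "css = []" by (auto simp: cycles_of_def id_def)
  have "fs = []" if "primitive_factorization 0 p fs" for fs
    using that by (cases fs) (auto simp: primitive_factorization_def)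
  then have "factorizations 0 p M = (if M = {#} then {[]} else {})"
    using \<open>p = id\<close> by (auto simp: factorizations_def primitive_factorization_def exponents_def)
  moreover have "forests (map (\<lambda>c. length c - 1) css) M = (if M = {#} then {[]} else {})"
    using \<open>css = []\<close> by (auto simp: forests_def)
  ultimately show ?case by simp
next
  case (Suc n)
  obtain xs css' where front: "cycles_of p ((xs @ [Suc n]) # css')"
    "mset (map length ((xs @ [Suc n]) # css')) = mset (map length css)"
    "set (concat ((xs @ [Suc n]) # css')) = set (concat css)"
    using Suc.prems(1) by (rule cycles_of_front[of _ _ "Suc n"]) (use Suc.prems(2) in simp)
  have len: "Suc (length css') = length css"
    using front(2) by (metis length_Cons length_map size_mset)
  have "card (partial_factorizations n 0 p M) =
      card (partial_forests 0 (length xs) (map (\<lambda>c. length c - 1) css') M)"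
  proof (rule card_partial_factorizations[OF _ front(1) _ Suc.prems(3)])
    show "set (concat ((xs @ [Suc n]) # css')) = {1..Suc n}"
      using front(3) Suc.prems(2) by (rule trans)
    show "sum_mset M + length css' = n + 0" using Suc.prems(4) len by simp
  qed (rule Suc.IH)
  then have "card (factorizations (Suc n) p M) =
      card (forests (map (\<lambda>c. length c - 1) ((xs @ [Suc n]) # css')) M)"
    by (simp add: factorizations_Suc card_partial_forests_0)
  also have "\<dots> = card (forests (map (\<lambda>c. length c - 1) css) M)"
  proof (rule card_forests_mset_cong)
    show "mset (map (\<lambda>c. length c - 1) ((xs @ [Suc n]) # css')) =
        mset (map (\<lambda>c. length c - 1) css)"
      using arg_cong[OF front(2), of "image_mset (\<lambda>l. l - 1)"]
      by (simp only: map_map comp_def flip: mset_map)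
  qed
  finally show ?case .
qed

section \<open>Back to types and reduced cycle types\<close>

lemma sum_nonzero:
  assumes "finite A"
  shows "(\<Sum>j\<in>A. nonzero (f j)) = filter_mset (\<lambda>a. a \<noteq> 0) (image_mset f (mset_set A))"
  using assms by induction (auto simp: nonzero_def)

text \<open>In a primitive factorization every second entry is at least 2, so the ranges starting at
  1 and at 2 yield the same multiset.\<close>

lemma factorization_type_eq_iff:
  assumes "primitive_factorization n p fs" "sorted_wrt (\<ge>) lam"
  shows "factorization_type n fs = lam \<longleftrightarrow> exponents n fs = mset lam"
proof -
  have "1 \<notin> set (map snd fs)"
    using assms(1) by (fastforce simp: primitive_factorization_def)
  then have "count_list (map snd fs) 1 = 0" by (rule count_notin)
  then have "exponents n fs = (\<Sum>j\<in>{2..n}. nonzero (count_list (map snd fs) j))"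
    unfolding exponents_def
  proof (intro sum.mono_neutral_right ballI)
    fix j assume "j \<in> {1..n} - {2..n}"
    then have "j = 1" by auto
    then show "nonzero (count_list (map snd fs) j) = {#}"
      using \<open>count_list (map snd fs) 1 = 0\<close> by simp
  qed auto
  then show ?thesis
    using assms(2) by (simp add: factorization_type_def decreasing_list_eq_iff sum_nonzero)
qed

theorem theorem1:
  fixes k n :: nat and \<pi> :: "nat \<Rightarrow> nat" and lam mu :: "nat list"
  assumes "k \<ge> 1" and "n \<ge> 1"
    and "\<pi> permutes {1..n}"
    and "integer_partition k mu" and "reduced_cycle_type n \<pi> = mu"
    and "integer_partition k lam"
  shows "card {fs. primitive_factorization n \<pi> fs \<and> factorization_type n fs = lam} =
           (\<Sum>ps \<in> refinements lam mu. prod_list (map RC ps))"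
proof -
  obtain xs where "\<forall>(a, b)\<in>set xs. a \<noteq> b \<and> a \<in> {1..n} \<and> b \<in> {1..n}" "apply_transps xs = \<pi>"
    using permutes_from_transpositions[OF assms(3)] by auto
  then obtain css where css: "cycles_of \<pi> css" "set (concat css) = {1..n}"
    using ex_cycles_of_apply_transps[of "{1..n}" xs] by auto
  let ?es = "map (\<lambda>c. length c - 1) css"
  have "mset (cycle_type n \<pi>) = mset (map length css)"
    using cycles_of_orbits[OF css(1)] css(2) by (simp add: cycle_type_def decreasing_list_def)
  then have "image_mset (\<lambda>l. l - 1) (mset (cycle_type n \<pi>)) = mset ?es"
    by (simp add: image_mset.compositionality comp_def)
  then have mu: "mset mu = mset (filter (\<lambda>e. e \<noteq> 0) ?es)"
    unfolding assms(5)[symmetric] reduced_cycle_type_def by (metis mset_filter mset_map)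
  have "sum_list mu = sum_list ?es"
  proof -
    have "sum_list (filter (\<lambda>e. e \<noteq> 0) es) = sum_list es" for es :: "nat list"
      by (induction es) auto
    then show ?thesis using mu by (metis sum_mset_sum_list)
  qed
  moreover have "sum_list ?es + length css = length (concat css)"
    using css(1) by (induction css) (auto simp: cycles_of_Cons Suc_le_eq)
  moreover have "length (concat css) = n"
    using css distinct_card[of "concat css"] by (simp add: cycles_of_def)
  \<comment> \<open>The sum of \<open>mu\<close> is \<open>n\<close> minus the number of cycles,
    fixed points included, so a factorization of type \<open>lam\<close> has the least possible
    length.\<close>
  ultimately have min: "sum_mset (mset lam) + length css = n"
    using assms(4,6) by (simp add: integer_partition_def sum_mset_sum_list)
  have "{fs. primitive_factorization n \<pi> fs \<and> factorization_type n fs = lam} =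
      factorizations n \<pi> (mset lam)"
    using assms(6) factorization_type_eq_iff by (auto simp: factorizations_def integer_partition_def)
  also have "card \<dots> = card (forests ?es (mset lam))"
    by (rule card_factorizations[OF css assms(3) min])
  \<comment> \<open>Fixed points give trees without edges, which \<open>mu\<close> omits.\<close>
  also have "\<dots> = card (forests (filter (\<lambda>e. e \<noteq> 0) ?es) (mset lam))"
    by (rule card_forests_filter[symmetric])
  also have "\<dots> = card (forests mu (mset lam))"
    by (rule card_forests_mset_cong) (simp add: mu)
  also have "\<dots> = (\<Sum>ps \<in> refinements lam mu. prod_list (map RC ps))"
    using assms(4) by (simp add: sum_RC_eq_card_forests integer_partition_def)
  finally show ?thesis .
qed

end
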